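(* Regardless of the feature value of the input, any translation vector that is added to a one-hot categorical input can alternatively be expressed using If/Then rules, with just one unique Then condition. That is, let $\delta=(\delta_1,\dots,\delta_n)\in\mathbb{R}^n$ be any translation vector and let $\Delta=\arg\max_i\delta_i$. For every input feature value $F\in\{1,\dots,n\}$, with $G$ denoting the feature value after translation by $\delta$: if $G\neq F$ (i.e. a change in feature value occurs), then $G=\Delta$, so the change is given by the rule "If $F$, Then $\Delta$". The Then condition $\Delta$ is the same for all $F$.
   Context: A categorical feature with values $1,\dots,n$ is one-hot encoded as a vector $f=(f_1,\dots,f_n)\in\{0,1\}^n$ with exactly one entry equal to $1$; the feature value of the input is $F=\arg\max_i f_i$. Adding a translation $\delta\in\mathbb{R}^n$ gives $g=f+\delta$, which is re-encoded by selecting its largest entry, so the feature value after translation is $G=\arg\max_i g_i$. Each $\arg\max$ denotes the index of the largest entry and is written as a single index. A rule "If $F$, Then $H$" means that inputs with feature value $F$ are changed to feature value $H$; inputs with a feature value for which there is no rule are left unchanged. *)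

theory Defs
  imports "HOL-Analysis.Analysis"
begin

text \<open>
  Categories are the elements of a finite linearly ordered type, so a type with \<open>CARD('n) = n\<close>
  plays the role of \<open>1 < \<dots> < n\<close>.

  The index of the largest entry has to be single-valued even when several entries are maximal;
  ties go to the smallest index.  Since the order on \<open>'n\<close> is arbitrary, this covers every
  tie-breaking rule given by a fixed ranking of the categories (and any rule at all on vectors
  whose maximum is unique).  The library's \<open>arg_max\<close> is not suitable: its choice
  among tied indices in different vectors is unrelated.
\<close>

definition argmax :: "real ^ 'n::{finite,linorder} \<Rightarrow> 'n"
  where "argmax v = (LEAST i. is_arg_max (\<lambda>j. v $ j) (\<lambda>_. True) i)"

definition one_hot :: "real ^ 'n \<Rightarrow> bool"
  where "one_hot f \<longleftrightarrow> (\<forall>i. f $ i \<in> {0, 1}) \<and> (\<exists>!i. f $ i = 1)"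

text \<open>
  A finite set of rules is a partial map: \<open>R F = Some H\<close> is the rule ``If \<open>F\<close>, Then \<open>H\<close>'', and
  \<open>R F = None\<close> says that there is no rule for \<open>F\<close>.  Thus \<open>ran R\<close> is the set of Then conditions.
\<close>

definition apply_rules :: "('n \<rightharpoonup> 'n) \<Rightarrow> 'n \<Rightarrow> 'n"
  where "apply_rules R F = (case R F of None \<Rightarrow> F | Some H \<Rightarrow> H)"

end

(* Adding a one-hot vector raises only the entry at F.  If the largest entry of the sum is at
   G \<noteq> F, then G beats every other index already for \<delta> alone, and it beats F a fortiori. *)
theory Submission imports Defs begin

text \<open>A one-hot input is the unit vector at its own feature value F, so translation compares
  the entries of \<delta> with only the entry at F raised by 1. If the winner G is not F, all
  comparisons of G with indices other than F, ties included, are those of \<delta> itself, and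
  lowering the loser F cannot dethrone G (\<open>argmax_axis_add\<close>). Hence G is the argmax of
  \<delta>, whatever F was.\<close>

lemma argmax_eq_iff:
  "argmax v = k \<longleftrightarrow> (\<forall>j. v $ j < v $ k \<or> v $ j = v $ k \<and> k \<le> j)"
proof -
  have least: "argmax v = k" if k: "\<forall>j. v $ j < v $ k \<or> v $ j = v $ k \<and> k \<le> j" for k
    unfolding argmax_def
  proof (rule Least_equality)
    show "is_arg_max (($) v) (\<lambda>_. True) k"
      using k by (auto simp: is_arg_max_linorder le_less)
    show "k \<le> i" if "is_arg_max (($) v) (\<lambda>_. True) i" for i
      using that k unfolding is_arg_max_linorder by (meson not_less)
  qed
  \<comment> \<open>By finiteness a smallest maximiser exists. It meets the criterion, so
    \<open>least\<close> identifies it with \<open>argmax v\<close>; this gives the forward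
    implication.\<close>
  define M where "M = {i. \<forall>j. v $ j \<le> v $ i}"
  have "Max (range (($) v)) \<in> range (($) v)"
    by (intro Max_in) auto
  then obtain i where "v $ i = Max (range (($) v))"
    by force
  then have "M \<noteq> {}"
    unfolding M_def by (auto intro!: exI[of _ i])
  then have "Min M \<in> M"
    by (intro Min_in) auto
  moreover have "Min M \<le> j" if "v $ j = v $ Min M" for j
    using that \<open>Min M \<in> M\<close> by (intro Min_le) (auto simp: M_def)
  ultimately have "\<forall>j. v $ j < v $ Min M \<or> v $ j = v $ Min M \<and> Min M \<le> j"
    by (auto simp: M_def less_le)
  with least show ?thesis
    by metis
qed

text \<open>Makes the outcome of a translation depend on the feature value alone, so that it can be
  written as rules indexed by that value.\<close>

lemma one_hot_eq_axis_argmax: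
  assumes "one_hot f"
  shows "f = axis (argmax f) 1"
proof -
  obtain i where i: "f $ i = 1" "\<And>j. f $ j = 1 \<Longrightarrow> j = i"
    using assms by (auto simp: one_hot_def)
  moreover have "f $ j = 0 \<or> f $ j = 1" for j
    using assms by (auto simp: one_hot_def)
  ultimately have "f $ j = (if j = i then 1 else 0)" for j
    by metis
  then have "f = axis i 1"
    by (simp add: vec_eq_iff axis_def)
  moreover have "argmax (axis i (1::real)) = i"
    by (simp add: argmax_eq_iff axis_def)
  ultimately show ?thesis
    by simp
qed

lemma argmax_axis_add:
  assumes "c \<ge> 0" and "argmax (axis k c + v) \<noteq> k"
  shows "argmax (axis k c + v) = argmax v"
proof -
  define m where "m = argmax (axis k c + v)"
  have "(axis k c + v) $ j < (axis k c + v) $ m \<or> (axis k c + v) $ j = (axis k c + v) $ m \<and> m \<le> j"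
    for j using argmax_eq_iff[of "axis k c + v" m] by (simp add: m_def)
  note le = this
  \<comment> \<open>For \<open>j = k\<close>, \<open>v $ k\<close> is at most
    \<open>v $ k + c\<close>, which loses to \<open>v $ m\<close>, possibly by a tie with
    \<open>m \<le> k\<close>. For other \<open>j\<close> both entries are unchanged, since
    \<open>m\<close> is not \<open>k\<close>.\<close>
  have "v $ j < v $ m \<or> v $ j = v $ m \<and> m \<le> j" for j
    using le[of j] assms(1) assms(2)[folded m_def] by (cases "j = k") (force simp: axis_def)+
  then show ?thesis
    unfolding m_def[symmetric] by (metis argmax_eq_iff)
qed

theorem theorem4p1:
  fixes \<delta> :: "real ^ 'n::{finite,linorder}"
  shows "\<exists>R. ran R \<subseteq> {argmax \<delta>} \<and>
    (\<forall>F f G. one_hot f \<and> F = argmax f \<and> G = argmax (f + \<delta>) \<longrightarrow>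
       apply_rules R F = G \<and>
       (G \<noteq> F \<longrightarrow> G = argmax \<delta> \<and> R F = Some (argmax \<delta>)))"
proof -
  \<comment> \<open>A rule is present only where the value changes: a value that survives
    translation need not be \<open>argmax \<delta>\<close>.\<close>
  define R where
    "R F = (if argmax (axis F 1 + \<delta>) = F then None else Some (argmax \<delta>))" for F
  have "ran R \<subseteq> {argmax \<delta>}"
    by (auto simp: R_def ran_def split: if_splits)
  moreover have "apply_rules R F = G \<and> (G \<noteq> F \<longrightarrow> G = argmax \<delta> \<and> R F = Some (argmax \<delta>))"
    if "one_hot f" "F = argmax f" "G = argmax (f + \<delta>)" for F f G
  proof -
    have "G = argmax (axis F 1 + \<delta>)"
      using one_hot_eq_axis_argmax[OF that(1)] that(2,3) by metis
    then show ?thesis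
      using argmax_axis_add[of 1 F \<delta>] by (auto simp: R_def apply_rules_def)
  qed
  ultimately show ?thesis
    by blast
qed

end
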